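(* Let $\phi(t)=\sum_{k=1}^n c_k\cos(m_kt)$ and $\psi(t)=\sum_{k=1}^n d_k\sin(m_kt)$, where $c_k,d_k\in\mathbb{R}$ and the $m_k$ are coprime integers all of which are odd, and consider the plane curve $x=\phi(t)$, $y=\psi(t)$, $t\in\mathbb{R}$. Let $Q_1$ be a polynomial such that $\phi(t)=\cos(t)\,Q_1(\sin^2 t)$ for all $t\in\mathbb{R}$. Suppose that $u_0\in\mathbb{R}$ satisfies $$Q_1(1-u_0^2)=0,\qquad 0<u_0<1,$$ and that $t_1,t_2\in\mathbb{R}$ are such that $$u_0=\cos(t_1)=-\cos(t_2),\qquad \sin(t_1)=\sin(t_2)=\sqrt{1-u_0^2}.$$ Set $y_0:=\psi(t_1)$. Then the point $(0,y_0)$ is a self-intersection point of the curve if and only if $\dot\phi(t_1)\neq0$ and $\dot\psi(t_1)\neq 0$.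
   Context: Dots denote $d/dt$. The curve has a self-intersection at a point $(x_0,y_0)$ if it has different tangent lines at this point, i.e. if the slope $y'(x_0)=\dot\psi(t)/\dot\phi(t)$ (equivalently its reciprocal $x'(y_0)=\dot\phi(t)/\dot\psi(t)$; the value $\infty$ being allowed when only the denominator vanishes) takes different values for different parameter values $t$ with $(\phi(t),\psi(t))=(x_0,y_0)$. A polynomial $Q_1$ as in the claim always exists when all $m_k$ are odd.
   Formalization: "Only if" fails when another parameter passes through (0,y_0) with another slope; so the equivalence is proved for the branches at t_1, t_2, "if" for the whole curve, and the equivalence for the whole curve when only t_1, t_2 (mod 2π) reach (0,y_0). *)

theory Defs
  imports "HOL-Analysis.Analysis" "HOL-Computational_Algebra.Polynomial"
begin

text \<open>The slope of \<open>x = \<phi> t, y = \<psi> t\<close> at the parameter \<open>t\<close>. This is a relation because there is no slope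
  when both derivatives vanish. The value \<open>\<infinity>\<close> is the unsigned vertical direction; \<open>-\<infinity>\<close> is never a slope.\<close>

definition has_slope :: "(real \<Rightarrow> real) \<Rightarrow> (real \<Rightarrow> real) \<Rightarrow> real \<Rightarrow> ereal \<Rightarrow> bool" where
  "has_slope \<phi> \<psi> t s \<longleftrightarrow>
     (deriv \<phi> t \<noteq> 0 \<and> s = ereal (deriv \<psi> t / deriv \<phi> t)) \<or>
     (deriv \<phi> t = 0 \<and> deriv \<psi> t \<noteq> 0 \<and> s = \<infinity>)"

text \<open>The slope takes different values for different parameters in \<open>T\<close> at which the curve passes through
  \<open>(x0, y0)\<close>. For \<open>T = UNIV\<close> this is a self-intersection point of the whole curve; for \<open>T = {t1, t2}\<close> it
  is a self-intersection formed by the two branches through \<open>t1\<close> and \<open>t2\<close>.\<close>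

definition self_intersection_on ::
    "real set \<Rightarrow> (real \<Rightarrow> real) \<Rightarrow> (real \<Rightarrow> real) \<Rightarrow> real \<Rightarrow> real \<Rightarrow> bool" where
  "self_intersection_on T \<phi> \<psi> x0 y0 \<longleftrightarrow>
     (\<exists>t\<in>T. \<exists>t'\<in>T. \<exists>s s'.
        \<phi> t = x0 \<and> \<psi> t = y0 \<and> \<phi> t' = x0 \<and> \<psi> t' = y0 \<and>
        has_slope \<phi> \<psi> t s \<and> has_slope \<phi> \<psi> t' s' \<and> s \<noteq> s')"

abbreviation self_intersection ::
    "(real \<Rightarrow> real) \<Rightarrow> (real \<Rightarrow> real) \<Rightarrow> real \<Rightarrow> real \<Rightarrow> bool" where
  "self_intersection \<equiv> self_intersection_on UNIV"

end

theory Submission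
  imports Defs
begin

text \<open>Since all frequencies are odd, the substitution \<open>t \<mapsto> pi - t\<close> reflects the curve in the
  \<open>y\<close>-axis: \<open>\<phi> (pi - t) = - \<phi> t\<close> and \<open>\<psi> (pi - t) = \<psi> t\<close>. The conditions on \<open>t1\<close> and \<open>t2\<close> imply that
  \<open>t2\<close> is \<open>pi - t1\<close> up to a multiple of \<open>2 * pi\<close>. A root \<open>1 - u0\<^sup>2 = (sin t1)\<^sup>2\<close> of \<open>Q1\<close> puts the point at
  parameter \<open>t1\<close> on the mirror axis, so both parameters give the same point \<open>(0, y0)\<close>, and the two
  branches through it are mirror images of each other.

  Differentiating the symmetry gives \<open>\<phi>' t2 = \<phi>' t1\<close> and \<open>\<psi>' t2 = - \<psi>' t1\<close>: the tangent at \<open>t2\<close>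
  is the mirror image of the one at \<open>t1\<close>. A direction differs from its mirror image unless it is
  horizontal (\<open>\<psi>' t1 = 0\<close>) or vertical (\<open>\<phi>' t1 = 0\<close>); this is \<open>self_intersection_on_mirror_pair\<close>. If
  no parameters other than \<open>t1\<close>, \<open>t2\<close> and their translates by periods reach the point, periodicity of the slope
  (\<open>has_slope_periodic\<close>) shows that the whole curve has no further slopes there.\<close>

lemma deriv_periodic:
  fixes f :: "real \<Rightarrow> real"
  assumes "\<And>t. f (t + p) = f t"
  shows "deriv f (t + p) = deriv f t"
  unfolding deriv_def DERIV_shift using assms by simp

text \<open>For a symmetry the factor \<open>e\<close> is \<open>1\<close> (as for \<open>\<psi>\<close>) or \<open>- 1\<close> (as for \<open>\<phi>\<close>), and the chain rule flips
  its sign: this is why \<open>\<phi>'\<close> agrees at mirror parameters while \<open>\<psi>'\<close> changes sign.\<close>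

lemma deriv_reflect:
  fixes f :: "real \<Rightarrow> real"
  assumes sym: "\<And>t. f t = e * f (a - t)"
    and diff: "f differentiable at t"
  shows "deriv f (a - t) = - e * deriv f t"
proof -
  have "DERIV f t :> deriv f t"
    using diff by (simp add: DERIV_deriv_iff_real_differentiable)
  then have "DERIV f (a - (a - t)) :> deriv f t"
    by simp
  then have "DERIV (\<lambda>s. f (a - s)) (a - t) :> deriv f t * (0 - 1)"
    by (rule DERIV_chain2) (auto intro!: derivative_eq_intros)
  then have "DERIV (\<lambda>s. e * f (a - s)) (a - t) :> - e * deriv f t"
    by (auto intro!: derivative_eq_intros)
  then have "DERIV f (a - t) :> - e * deriv f t"
    by (simp flip: sym)
  then show ?thesis
    by (rule DERIV_imp_deriv)
qed

lemma has_slope_periodic: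
  assumes "\<And>t. \<phi> (t + p) = \<phi> t" "\<And>t. \<psi> (t + p) = \<psi> t"
  shows "has_slope \<phi> \<psi> (t + p) s \<longleftrightarrow> has_slope \<phi> \<psi> t s"
  using deriv_periodic[of \<phi> p t] deriv_periodic[of \<psi> p t] assms by (simp add: has_slope_def)

lemma self_intersection_on_mono:
  assumes "S \<subseteq> T" "self_intersection_on S \<phi> \<psi> x0 y0"
  shows "self_intersection_on T \<phi> \<psi> x0 y0"
  using assms unfolding self_intersection_on_def by blast

text \<open>A self-intersection only depends on the set of slopes at the point, so it is already visible on a
  set of parameters that realises all of them.\<close>

lemma self_intersection_on_representatives:
  assumes "\<And>t. \<phi> t = x0 \<Longrightarrow> \<psi> t = y0 \<Longrightarrow>
      \<exists>r\<in>T. \<phi> r = x0 \<and> \<psi> r = y0 \<and> (\<forall>s. has_slope \<phi> \<psi> t s \<longrightarrow> has_slope \<phi> \<psi> r s)"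
    and "self_intersection \<phi> \<psi> x0 y0"
  shows "self_intersection_on T \<phi> \<psi> x0 y0"
  using assms unfolding self_intersection_on_def by meson

text \<open>With slope \<open>s\<close> at \<open>t1\<close> and \<open>- s\<close> at \<open>t2\<close>, the slopes differ iff \<open>s \<noteq> 0\<close>; a vertical tangent is its
  own mirror image, and if both derivatives vanish at \<open>t1\<close>, neither branch has a slope.\<close>

lemma self_intersection_on_mirror_pair:
  assumes point: "\<phi> t1 = x0" "\<psi> t1 = y0" "\<phi> t2 = x0" "\<psi> t2 = y0"
    and mirror: "deriv \<phi> t2 = deriv \<phi> t1" "deriv \<psi> t2 = - deriv \<psi> t1"
  shows "self_intersection_on {t1, t2} \<phi> \<psi> x0 y0 \<longleftrightarrow> deriv \<phi> t1 \<noteq> 0 \<and> deriv \<psi> t1 \<noteq> 0"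
  using assms by (auto simp: self_intersection_on_def has_slope_def)

lemma odd_multiple_reflect:
  assumes "odd m" "odd j"
  shows cos_odd_multiple_reflect: "cos (of_int m * (of_int j * pi - t)) = - cos (of_int m * t)"
    and sin_odd_multiple_reflect: "sin (of_int m * (of_int j * pi - t)) = sin (of_int m * t)"
proof -
  have eq: "of_int m * (of_int j * pi - t) = pi * of_int (m * j) - of_int m * t"
    by (simp add: algebra_simps)
  have "cos (pi * of_int (m * j)) = -1" "sin (pi * of_int (m * j)) = 0"
    using assms by (auto simp only: cos_npi_int sin_npi_int even_mult_iff if_False simp_thms)
  then show "cos (of_int m * (of_int j * pi - t)) = - cos (of_int m * t)"
    and "sin (of_int m * (of_int j * pi - t)) = sin (of_int m * t)"
    unfolding eq cos_diff sin_diff by simp_all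
qed

lemma int_multiple_periodic:
  fixes m k :: int
  shows cos_int_multiple_periodic: "cos (of_int m * (t + 2 * pi * of_int k)) = cos (of_int m * t)"
    and sin_int_multiple_periodic: "sin (of_int m * (t + 2 * pi * of_int k)) = sin (of_int m * t)"
proof -
  have "of_int m * (t + 2 * pi * of_int k) = of_int m * t + 2 * pi * of_int (m * k)"
    by (simp add: algebra_simps)
  then show "cos (of_int m * (t + 2 * pi * of_int k)) = cos (of_int m * t)"
    and "sin (of_int m * (t + 2 * pi * of_int k)) = sin (of_int m * t)"
    using sin_cos_eq_iff by metis+
qed

theorem theorem3p11:
  fixes n :: nat and c d :: "nat \<Rightarrow> real" and m :: "nat \<Rightarrow> int"
    and \<phi> \<psi> :: "real \<Rightarrow> real" and Q1 :: "real poly" and u0 t1 t2 y0 :: real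
  assumes phi: "\<And>t. \<phi> t = (\<Sum>k=1..n. c k * cos (of_int (m k) * t))"
    and psi: "\<And>t. \<psi> t = (\<Sum>k=1..n. d k * sin (of_int (m k) * t))"
    and coprime: "Gcd (m ` {1..n}) = 1"
    and odd: "\<And>k. k \<in> {1..n} \<Longrightarrow> odd (m k)"
    and Q1: "\<And>t. \<phi> t = cos t * poly Q1 ((sin t)\<^sup>2)"
    and root: "poly Q1 (1 - u0\<^sup>2) = 0"
    and u0: "0 < u0" "u0 < 1"
    and cos12: "u0 = cos t1" "u0 = - cos t2"
    and sin12: "sin t1 = sqrt (1 - u0\<^sup>2)" "sin t2 = sqrt (1 - u0\<^sup>2)"
    and y0: "y0 = \<psi> t1"
  shows "(self_intersection_on {t1, t2} \<phi> \<psi> 0 y0 \<longleftrightarrow> deriv \<phi> t1 \<noteq> 0 \<and> deriv \<psi> t1 \<noteq> 0)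
    \<and> (deriv \<phi> t1 \<noteq> 0 \<and> deriv \<psi> t1 \<noteq> 0 \<longrightarrow> self_intersection \<phi> \<psi> 0 y0)
    \<and> ((\<forall>t. \<phi> t = 0 \<and> \<psi> t = y0 \<longrightarrow> (\<exists>k::int. t = t1 + 2 * pi * k \<or> t = t2 + 2 * pi * k)) \<longrightarrow>
        (self_intersection \<phi> \<psi> 0 y0 \<longleftrightarrow> deriv \<phi> t1 \<noteq> 0 \<and> deriv \<psi> t1 \<noteq> 0))"
proof -
  have u0_sq: "sqrt (1 - u0\<^sup>2) ^ 2 = 1 - u0\<^sup>2"
    using u0 by (simp add: abs_square_le_1)
  have "sin t2 = sin (pi - t1)" "cos t2 = cos (pi - t1)"
    using sin12 cos12 by (auto simp: cos_diff)
  then obtain k :: int where k: "t2 = (pi - t1) + 2 * pi * k"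
    using sin_cos_eq_iff by metis
  define j where "j = 2 * k + 1"
  define a where "a = of_int j * pi"
  have "odd j"
    by (simp add: j_def)
  have t2: "t2 = a - t1"
    by (simp add: k a_def j_def algebra_simps)

  have phi_reflect: "\<phi> t = (-1) * \<phi> (a - t)" for t
    using odd \<open>odd j\<close> by (simp add: phi a_def cos_odd_multiple_reflect sum_negf)
  have psi_reflect: "\<psi> t = 1 * \<psi> (a - t)" for t
    using odd \<open>odd j\<close> by (simp add: psi a_def sin_odd_multiple_reflect)
  have phi_periodic: "\<phi> (t + 2 * pi * of_int i) = \<phi> t" for t and i :: int
    by (simp only: phi cos_int_multiple_periodic)
  have psi_periodic: "\<psi> (t + 2 * pi * of_int i) = \<psi> t" for t and i :: int
    by (simp only: psi sin_int_multiple_periodic)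

  have "((\<lambda>t. cos (r * t)) has_real_derivative - sin (r * t1) * r) (at t1)"
    "((\<lambda>t. sin (r * t)) has_real_derivative cos (r * t1) * r) (at t1)" for r
    by (auto intro!: derivative_eq_intros)
  then have trig_diff: "(\<lambda>t. cos (r * t)) differentiable at t1" "(\<lambda>t. sin (r * t)) differentiable at t1" for r
    unfolding real_differentiable_def by blast+
  have "\<phi> differentiable at t1" "\<psi> differentiable at t1"
    unfolding ext[of \<phi>, OF phi] ext[of \<psi>, OF psi] by (auto intro!: derivative_intros trig_diff)
  then have derivs: "deriv \<phi> t2 = deriv \<phi> t1" "deriv \<psi> t2 = - deriv \<psi> t1"
    unfolding t2
    using deriv_reflect[of \<phi>, OF phi_reflect] deriv_reflect[of \<psi>, OF psi_reflect] by auto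

  have point1: "\<phi> t1 = 0" "\<psi> t1 = y0"
    using Q1[of t1] root u0_sq by (simp_all add: sin12 y0)
  then have point2: "\<phi> t2 = 0" "\<psi> t2 = y0"
    using phi_reflect[of t1] psi_reflect[of t1] by (simp_all add: t2)

  have pair: "self_intersection_on {t1, t2} \<phi> \<psi> 0 y0 \<longleftrightarrow> deriv \<phi> t1 \<noteq> 0 \<and> deriv \<psi> t1 \<noteq> 0"
    using point1 point2 derivs by (rule self_intersection_on_mirror_pair)
  have whole: "self_intersection_on {t1, t2} \<phi> \<psi> 0 y0 \<Longrightarrow> self_intersection \<phi> \<psi> 0 y0"
    by (rule self_intersection_on_mono) auto
  have restrict: "self_intersection_on {t1, t2} \<phi> \<psi> 0 y0"
    if only: "\<forall>t. \<phi> t = 0 \<and> \<psi> t = y0 \<longrightarrow> (\<exists>k::int. t = t1 + 2 * pi * k \<or> t = t2 + 2 * pi * k)"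
      and "self_intersection \<phi> \<psi> 0 y0"
  proof (rule self_intersection_on_representatives)
    fix t
    assume "\<phi> t = 0" "\<psi> t = y0"
    then obtain r and i :: int where "r \<in> {t1, t2}" "t = r + 2 * pi * of_int i"
      using only by blast
    then show "\<exists>r\<in>{t1, t2}. \<phi> r = 0 \<and> \<psi> r = y0 \<and> (\<forall>s. has_slope \<phi> \<psi> t s \<longrightarrow> has_slope \<phi> \<psi> r s)"
      using point1 point2 has_slope_periodic[of \<phi> _ \<psi>, OF phi_periodic psi_periodic] by blast
  qed (fact that)
  show ?thesis
    using pair whole restrict by blast
qed

end
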